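(* Let $\Phi\in\Psi$, let $S_n\subseteq C([a,b])$ be an $n$-dimensional Tchebycheff space in $[a,b]$, and let $f$ be a continuous function on $[a,b]$. Then there exists a unique best $\Phi$-approximation of $f$ in $[a,b]$ from the class $S_n$.
   Context: All functions are real-valued and measure is Lebesgue measure on the compact interval $[a,b]$. $\Im$ is the class of all non-decreasing functions $\varphi$ defined for all real $t\ge 0$ with $\varphi(t)>0$ for $t>0$. $\Psi$ is the class of all convex functions $\Phi(x)=\int_0^x\varphi(t)\,dt$, $x\ge 0$, with $\varphi\in\Im$; it is assumed throughout that $\Phi$ satisfies the $\Delta_2$ condition: there is a constant $\Lambda>0$ with $\Phi(2x)\le\Lambda\Phi(x)$ for all $x\ge0$. A best $\Phi$-approximation of $f$ from $S_n$ is an element $P\in S_n$ with $\int_a^b\Phi(|f-P|)\,dx=\inf_{Q\in S_n}\int_a^b\Phi(|f-Q|)\,dx$. An $n$-dimensional linear space $S_n\subseteq C([a,b])$ is called a Tchebycheff space if every nonzero element of $S_n$ has at most $n-1$ zeros in $[a,b]$. *)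

theory Defs
  imports "HOL-Analysis.Analysis" "HOL-Library.Function_Algebras"
begin

text \<open>Pointwise scalar multiplication, complementing the pointwise addition of
  \<^theory>\<open>HOL-Library.Function_Algebras\<close>, so that \<^const>\<open>span\<close>, \<^const>\<open>independent\<close> and
  \<^const>\<open>subspace\<close> apply to spaces of functions.\<close>

instantiation "fun" :: (type, real_vector) real_vector
begin

definition scaleR_fun :: "real \<Rightarrow> ('a \<Rightarrow> 'b) \<Rightarrow> 'a \<Rightarrow> 'b"
  where "scaleR_fun c f = (\<lambda>x. c *\<^sub>R f x)"

instance
  by standard (auto simp: scaleR_fun_def fun_eq_iff scaleR_add_right scaleR_add_left)

end

text \<open>Each continuous function on \<open>[a,b]\<close> is represented by its extension by zero to the real
  line. Hence two elements of \<open>cont_space a b\<close> are equal iff they agree on \<open>[a,b]\<close>, and an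
  element is nonzero iff it does not vanish identically on \<open>[a,b]\<close>.\<close>

definition cont_space :: "real \<Rightarrow> real \<Rightarrow> (real \<Rightarrow> real) set"
  where "cont_space a b = {g. continuous_on {a..b} g \<and> (\<forall>x. x \<notin> {a..b} \<longrightarrow> g x = 0)}"

text \<open>The dimension is expressed through a finite basis because \<^const>\<open>dim\<close> is \<open>0\<close> on
  infinite-dimensional spaces.\<close>

definition tchebycheff_space :: "real \<Rightarrow> real \<Rightarrow> nat \<Rightarrow> (real \<Rightarrow> real) set \<Rightarrow> bool"
  where "tchebycheff_space a b n S \<longleftrightarrow>
    subspace S \<and> S \<subseteq> cont_space a b \<and>
    (\<exists>B. finite B \<and> card B = n \<and> independent B \<and> span B = S) \<and>
    (\<forall>g\<in>S. g \<noteq> 0 \<longrightarrow> finite {x \<in> {a..b}. g x = 0} \<and> card {x \<in> {a..b}. g x = 0} \<le> n - 1)"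

text \<open>The members of the two classes below are functions on \<open>[0,\<infinity>)\<close>; their values at negative
  arguments are unconstrained.\<close>

definition Im_class :: "(real \<Rightarrow> real) set"
  where "Im_class = {\<phi>. mono_on {0..} \<phi> \<and> (\<forall>t>0. \<phi> t > 0)}"

definition Psi_class :: "(real \<Rightarrow> real) set"
  where "Psi_class = {\<Phi>. convex_on {0..} \<Phi> \<and>
    (\<exists>\<phi>\<in>Im_class. \<forall>x\<ge>0. \<Phi> x = (LINT t:{0..x}|lebesgue. \<phi> t))}"

definition Delta2 :: "(real \<Rightarrow> real) \<Rightarrow> bool"
  where "Delta2 \<Phi> \<longleftrightarrow> (\<exists>\<Lambda>>0. \<forall>x\<ge>0. \<Phi> (2 * x) \<le> \<Lambda> * \<Phi> x)"

definition best_approximation ::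
  "real \<Rightarrow> real \<Rightarrow> (real \<Rightarrow> real) \<Rightarrow> (real \<Rightarrow> real) set \<Rightarrow> (real \<Rightarrow> real) \<Rightarrow> (real \<Rightarrow> real) \<Rightarrow> bool"
  where "best_approximation a b \<Phi> S f P \<longleftrightarrow> P \<in> S \<and>
    (LINT x:{a..b}|lebesgue. \<Phi> \<bar>f x - P x\<bar>) =
      (INF Q\<in>S. LINT x:{a..b}|lebesgue. \<Phi> \<bar>f x - Q x\<bar>)"

end

theory Submission
  imports Defs
begin

text \<open>
  Put \<open>G x = \<Phi> \<bar>x\<bar>\<close>. This is a convex function on the line that vanishes at \<open>0\<close> and is positive
  elsewhere, and the theorem concerns the minimizers of \<open>J Q = \<integral> G (f - Q)\<close> over \<open>S\<close>.

  Existence is a compactness argument in the finitely many coefficients with respect to a basis: \<open>J\<close> is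
  continuous, and coercive because \<open>G\<close> grows at least linearly (\<open>exists_minimizer\<close>).

  For uniqueness strict convexity is not available: \<open>G x = \<bar>x\<bar>\<close>, that is approximation in the mean, is
  a typical case. The zeros of the elements of \<open>S\<close> take its place. If \<open>P1 \<noteq> P2\<close> are both optimal, so is
  their midpoint \<open>Q\<close>, and \<open>J Q = (J P1 + J P2) / 2\<close> forces equality in the pointwise convexity inequality.
  At a zero of \<open>e = f - Q\<close> this means \<open>G (f - P1) + G (f - P2) = 0\<close>, so \<open>P1\<close> and \<open>P2\<close> agree there;
  consequently \<open>e\<close> has at most \<open>n - 1\<close> zeros.

  A function with at most \<open>n - 1\<close> zeros has a partner \<open>R \<noteq> 0\<close> in \<open>S\<close> with \<open>e R \<ge> 0\<close> on \<open>[a,b)\<close>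
  (\<open>sign_matching\<close>).
  It is found by prescribing the zeros of \<open>R\<close> at the sign changes of \<open>e\<close>, with surplus
  zeros pushed towards the endpoint \<open>b\<close>. Once \<open>R\<close> has \<open>n - 1\<close> zeros, each interior one is a sign
  change of \<open>R\<close>, because a zero without change of sign could be split into two
  (\<open>tchebycheff_no_double_zero\<close>). Since \<open>e R > 0\<close> outside a
  finite set, passing from \<open>Q\<close> to \<open>Q + s R\<close> with small \<open>s > 0\<close> strictly decreases \<open>J\<close>
  (\<open>descent_direction\<close>), which contradicts the optimality of \<open>Q\<close>.
\<close>

section \<open>Finite-dimensional function spaces\<close>

text \<open>The coefficient vectors \<open>c\<close> are functions on the basis itself, so that
  they live in a product space: its topology makes boxes compact, whatever the dimension.\<close>
definition lincomb :: "('a \<Rightarrow> real) set \<Rightarrow> (('a \<Rightarrow> real) \<Rightarrow> real) \<Rightarrow> 'a \<Rightarrow> real"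
  where "lincomb B c x = (\<Sum>u\<in>B. c u * u x)"

lemma sum_fun_apply: "(\<Sum>i\<in>A. f i) x = (\<Sum>i\<in>A. f i x)"
  for f :: "'i \<Rightarrow> 'a \<Rightarrow> 'b::comm_monoid_add"
  by (induction A rule: infinite_finite_induct) auto

lemma lincomb_eq_sum: "lincomb B c = (\<Sum>u\<in>B. c u *\<^sub>R u)"
  by (auto simp: fun_eq_iff sum_fun_apply scaleR_fun_def lincomb_def)

lemma span_eq_range_lincomb: "finite B \<Longrightarrow> span B = range (lincomb B)"
  by (auto simp: span_finite lincomb_eq_sum)

lemma lincomb_eq_0D:
  assumes "finite B" "independent B" "lincomb B c = 0" "u \<in> B"
  shows "c u = 0"
  using assms independentD[of B B c u] by (auto simp: lincomb_eq_sum)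

lemma lincomb_cong: "(\<And>u. u \<in> B \<Longrightarrow> c u = d u) \<Longrightarrow> lincomb B c = lincomb B d"
  by (auto simp: lincomb_def fun_eq_iff intro: sum.cong)

lemma continuous_on_lincomb_coeff: "continuous_on A (\<lambda>c. lincomb B c x)"
  unfolding lincomb_def
  by (intro continuous_intros continuous_on_subset[OF continuous_on_product_coordinates]) auto

lemma continuous_on_lincomb:
  assumes "\<And>u. u \<in> B \<Longrightarrow> continuous_on I u"
  shows "continuous_on I (lincomb B c)"
proof -
  have "continuous_on I (\<lambda>x. \<Sum>u\<in>B. c u * u x)"
    by (intro continuous_intros assms)
  then show ?thesis by (simp add: lincomb_def[abs_def])
qed

lemma continuous_on_lincomb_joint:
  assumes "\<And>u. u \<in> B \<Longrightarrow> continuous_on I u"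
  shows "continuous_on (A \<times> I) (\<lambda>(c, x). lincomb B c x)"
  unfolding lincomb_def case_prod_unfold
proof (intro continuous_intros)
  fix u assume "u \<in> B"
  show "continuous_on (A \<times> I) (\<lambda>p. fst p u)"
    by (rule continuous_on_compose2[OF continuous_on_product_coordinates[of u] continuous_on_fst])
       (auto intro: continuous_intros)
  show "continuous_on (A \<times> I) (\<lambda>p. u (snd p))"
    by (rule continuous_on_compose2[OF assms[OF \<open>u \<in> B\<close>]]) (auto intro: continuous_intros)
qed

text \<open>Gaussian elimination: either an equation is void, or it expresses one unknown
  through the others, and substituting removes one equation and one unknown.\<close>
lemma homogeneous_system_nontrivial_solution:
  fixes A :: "'u \<Rightarrow> 'z \<Rightarrow> real"
  assumes "finite Z" "finite B" "card Z < card B"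
  shows "\<exists>c. (\<exists>u\<in>B. c u \<noteq> 0) \<and> (\<forall>z\<in>Z. (\<Sum>u\<in>B. c u * A u z) = 0)"
  using assms
proof (induction Z arbitrary: A B rule: finite_induct)
  case empty
  then obtain u where "u \<in> B" by (metis card.empty card_gt_0_iff ex_in_conv)
  then show ?case by (intro exI[of _ "\<lambda>_. 1"]) auto
next
  case (insert z Z)
  show ?case
  proof (cases "\<forall>u\<in>B. A u z = 0")
    case True
    obtain c where "\<exists>u\<in>B. c u \<noteq> 0" "\<forall>z\<in>Z. (\<Sum>u\<in>B. c u * A u z) = 0"
      using insert.IH[of B A] insert.prems insert.hyps by auto
    with True show ?thesis by (intro exI[of _ c]) auto
  next
    case False
    then obtain v where v: "v \<in> B" "A v z \<noteq> 0" by auto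
    define r where "r u = A u z / A v z" for u
    obtain c where c: "\<exists>u\<in>B-{v}. c u \<noteq> 0"
      "\<And>y. y\<in>Z \<Longrightarrow> (\<Sum>u\<in>B-{v}. c u * (A u y - r u * A v y)) = 0"
      using insert.IH[of "B-{v}" "\<lambda>u y. A u y - r u * A v y"] insert.prems insert.hyps v
      by (simp add: less_diff_conv) blast
    define s where "s = (\<Sum>u\<in>B-{v}. c u * r u)"
    define d where "d = c(v := - s)"
    have split: "(\<Sum>u\<in>B. d u * A u y) = - s * A v y + (\<Sum>u\<in>B-{v}. c u * A u y)" for y
    proof -
      have "(\<Sum>u\<in>B. d u * A u y) = d v * A v y + (\<Sum>u\<in>B-{v}. d u * A u y)"
        using v insert.prems by (simp add: sum.remove)
      also have "(\<Sum>u\<in>B-{v}. d u * A u y) = (\<Sum>u\<in>B-{v}. c u * A u y)"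
        by (intro sum.cong) (auto simp: d_def)
      finally show ?thesis by (simp add: d_def)
    qed
    have eq: "(\<Sum>u\<in>B. d u * A u y) = (\<Sum>u\<in>B-{v}. c u * (A u y - r u * A v y))" for y
      by (simp add: split s_def sum_subtractf right_diff_distrib sum_distrib_right mult.assoc)
    have "(\<Sum>u\<in>B. d u * A u z) = 0"
      unfolding eq using v by (simp add: r_def)
    moreover have "(\<Sum>u\<in>B. d u * A u y) = 0" if "y \<in> Z" for y
      unfolding eq using c(2) that by simp
    moreover have "\<exists>u\<in>B. d u \<noteq> 0"
      using c(1) by (auto simp: d_def)
    ultimately show ?thesis by (intro exI[of _ d]) auto
  qed
qed

text \<open>Fewer zeros than the dimension can always be prescribed, since each of them is one
  homogeneous linear equation for the coefficients.\<close>
lemma span_nonzero_vanishing_on: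
  fixes B :: "('a \<Rightarrow> real) set"
  assumes "finite B" "independent B" "finite Z" "card Z < card B"
  obtains g where "g \<in> span B" "g \<noteq> 0" "\<And>z. z \<in> Z \<Longrightarrow> g z = 0"
proof -
  obtain c where c: "\<exists>u\<in>B. c u \<noteq> 0" "\<forall>z\<in>Z. (\<Sum>u\<in>B. c u * u z) = 0"
    using homogeneous_system_nontrivial_solution[OF assms(3,1,4), of "\<lambda>u z. u z"] by auto
  show thesis
  proof
    show "lincomb B c \<in> span B" using assms by (auto simp: span_eq_range_lincomb)
    show "lincomb B c \<noteq> 0" using c(1) lincomb_eq_0D[OF assms(1,2)] by blast
    show "lincomb B c z = 0" if "z \<in> Z" for z using c(2) that by (simp add: lincomb_def)
  qed
qed

section \<open>Existence of a minimizer\<close>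

definition coeff_box :: "'u set \<Rightarrow> real \<Rightarrow> ('u \<Rightarrow> real) set"
  where "coeff_box B r = {c. \<forall>u. c u \<in> (if u \<in> B then {-r..r} else {0})}"

text \<open>Tychonoff: the factors outside \<open>B\<close> are the singleton \<open>{0}\<close>.\<close>
lemma compact_coeff_box: "compact (coeff_box B r)"
proof -
  have "compactin (product_topology (\<lambda>_. euclidean) UNIV)
      (PiE UNIV (\<lambda>u. if u \<in> B then {-r..r} else {0::real}))"
    by (subst compactin_PiE) auto
  moreover have "PiE UNIV (\<lambda>u. if u \<in> B then {-r..r} else {0::real}) = coeff_box B r"
    unfolding coeff_box_def PiE_UNIV_domain Pi_def by simp
  ultimately show ?thesis
    by (simp add: euclidean_product_topology)
qed

definition coeff_sphere :: "'u set \<Rightarrow> ('u \<Rightarrow> real) set"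
  where "coeff_sphere B = {c. (\<forall>u. u \<notin> B \<longrightarrow> c u = 0) \<and> (\<Sum>u\<in>B. \<bar>c u\<bar>) = 1}"

lemma compact_coeff_sphere:
  assumes "finite B"
  shows "compact (coeff_sphere B)"
proof -
  have "coeff_sphere B = coeff_box B 1 \<inter> {c. (\<Sum>u\<in>B. \<bar>c u\<bar>) = 1}"
  proof -
    have "\<bar>c u\<bar> \<le> 1" if "(\<Sum>u\<in>B. \<bar>c u\<bar>) = 1" "u \<in> B" for c :: "'a \<Rightarrow> real" and u
      using member_le_sum[of u B "\<lambda>u. \<bar>c u\<bar>"] that assms by auto
    then show ?thesis
      by (auto simp: coeff_sphere_def coeff_box_def abs_le_iff minus_le_iff split: if_splits)
  qed
  moreover have "closed {c::'a \<Rightarrow> real. (\<Sum>u\<in>B. \<bar>c u\<bar>) = 1}"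
    by (intro closed_Collect_eq continuous_intros continuous_on_product_coordinates)
  ultimately show ?thesis using compact_Int_closed[OF compact_coeff_box] by metis
qed

lemma lincomb_normalize:
  assumes "finite B" "\<exists>u\<in>B. c u \<noteq> 0"
  obtains s d where "s > 0" "d \<in> coeff_sphere B" "s = (\<Sum>u\<in>B. \<bar>c u\<bar>)"
    "\<And>x. lincomb B c x = s * lincomb B d x"
proof -
  define s where "s = (\<Sum>u\<in>B. \<bar>c u\<bar>)"
  have s: "s > 0" using assms unfolding s_def by (auto intro: sum_pos2)
  define d where "d u = (if u \<in> B then c u / s else 0)" for u
  have "(\<Sum>u\<in>B. \<bar>d u\<bar>) = (\<Sum>u\<in>B. \<bar>c u\<bar> / s)" using s by (intro sum.cong) (auto simp: d_def)
  also have "\<dots> = 1" using s by (simp add: s_def flip: sum_divide_distrib)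
  finally have "d \<in> coeff_sphere B" by (auto simp: coeff_sphere_def d_def)
  moreover have "lincomb B c x = s * lincomb B d x" for x
    unfolding lincomb_def sum_distrib_left using s by (intro sum.cong) (auto simp: d_def)
  ultimately show thesis using that s s_def by blast
qed

text \<open>By convexity the values beyond \<open>\<plusminus>1\<close> lie above the lines through the origin and the points of
  the graph over \<open>\<plusminus>1\<close>.\<close>
lemma convex_on_linear_growth:
  fixes G :: "real \<Rightarrow> real"
  assumes G: "convex_on UNIV G" "G 0 = 0" "\<And>x. x \<noteq> 0 \<Longrightarrow> G x > 0"
  obtains \<kappa> where "\<kappa> > 0" "\<And>t. G t \<ge> \<kappa> * (\<bar>t\<bar> - 1)"
proof
  define \<kappa> where "\<kappa> = min (G 1) (G (-1))"
  show k: "\<kappa> > 0" by (auto simp: \<kappa>_def G)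
  fix t
  show "G t \<ge> \<kappa> * (\<bar>t\<bar> - 1)"
  proof (cases "\<bar>t\<bar> \<le> 1")
    case True
    then have "\<kappa> * (\<bar>t\<bar> - 1) \<le> 0" using k by (simp add: mult_le_0_iff)
    also have "0 \<le> G t" using G(2,3) by (cases "t = 0") (auto intro: less_imp_le)
    finally show ?thesis .
  next
    case False
    have "G ((1 - 1/\<bar>t\<bar>) *\<^sub>R 0 + (1/\<bar>t\<bar>) *\<^sub>R t) \<le> (1 - 1/\<bar>t\<bar>) * G 0 + (1/\<bar>t\<bar>) * G t"
      using False by (intro convex_onD[OF G(1)]) auto
    then have "G (t / \<bar>t\<bar>) \<le> G t / \<bar>t\<bar>" using G(2) by simp
    moreover have "\<kappa> \<le> G (t / \<bar>t\<bar>)" using False by (cases "t > 0") (auto simp: \<kappa>_def)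
    ultimately have "\<kappa> \<le> G t / \<bar>t\<bar>" by simp
    then have "\<kappa> * \<bar>t\<bar> \<le> G t" using False by (subst (asm) pos_le_divide_eq) auto
    then show ?thesis using k by (simp add: algebra_simps)
  qed
qed

lemma convex_on_UNIV_continuous: "convex_on UNIV G \<Longrightarrow> continuous_on A G"
  for G :: "real \<Rightarrow> real"
  using convex_on_continuous[of UNIV G] continuous_on_subset by blast

lemma continuous_integral_functional:
  fixes G f :: "real \<Rightarrow> real"
  assumes G: "continuous_on UNIV G" and f: "continuous_on {a..b} f"
    and B: "\<And>u. u \<in> B \<Longrightarrow> continuous_on {a..b} u"
  shows "continuous_on A (\<lambda>c. integral {a..b} (\<lambda>x. G (f x - lincomb B c x)))"
proof -
  have "continuous_on (A \<times> {a..b}) (\<lambda>p. f (snd p))"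
    by (rule continuous_on_compose2[OF f]) (auto intro: continuous_intros)
  moreover have "continuous_on (A \<times> {a..b}) (\<lambda>p. lincomb B (fst p) (snd p))"
    using continuous_on_lincomb_joint[of B "{a..b}" A] B by (simp add: case_prod_unfold)
  ultimately have "continuous_on (A \<times> {a..b}) (\<lambda>p. f (snd p) - lincomb B (fst p) (snd p))"
    by (rule continuous_on_diff)
  then have "continuous_on (A \<times> {a..b}) (\<lambda>p. G (f (snd p) - lincomb B (fst p) (snd p)))"
    by (rule continuous_on_compose2[OF G]) auto
  then show ?thesis
    using integral_continuous_on_param[of A a b "\<lambda>c x. G (f x - lincomb B c x)"]
    by (simp add: case_prod_unfold)
qed

text \<open>The equivalence of norms on a finite-dimensional space, in the direction needed for coercivity:
  the \<open>L\<^sup>1\<close> norm is continuous and positive on the compact unit sphere of coefficients, so it has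
  a positive minimum there.\<close>
lemma L1_norm_lower_bound:
  assumes "a < b" and B: "finite B" "independent B" "B \<subseteq> cont_space a b"
  obtains m where "m > 0"
    "\<And>c. m * (\<Sum>u\<in>B. \<bar>c u\<bar>) \<le> integral {a..b} (\<lambda>x. \<bar>lincomb B c x\<bar>)"
proof (cases "B = {}")
  case True
  then show thesis by (intro that[of 1]) (auto simp: lincomb_def)
next
  case False
  define L where "L c = integral {a..b} (\<lambda>x. \<bar>lincomb B c x\<bar>)" for c
  have contB: "continuous_on {a..b} u" if "u \<in> B" for u
    using B(3) that by (auto simp: cont_space_def)
  have contL: "continuous_on (coeff_sphere B) L"
    unfolding L_def
    using continuous_integral_functional[where G=abs and f="\<lambda>_. 0" and B=B and a=a and b=b
        and A="coeff_sphere B"] contB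
    by (simp add: continuous_intros)
  obtain v where "v \<in> B" using False by auto
  then have "(\<lambda>u. if u = v then 1 else 0) \<in> coeff_sphere B"
    using B(1) by (auto simp: coeff_sphere_def if_distrib cong: if_cong)
  then obtain c0 where c0: "c0 \<in> coeff_sphere B" "\<And>d. d \<in> coeff_sphere B \<Longrightarrow> L c0 \<le> L d"
    using continuous_attains_inf[OF compact_coeff_sphere[OF B(1)] _ contL] by blast
  have contl: "continuous_on {a..b} (\<lambda>x. \<bar>lincomb B c x\<bar>)" for c
    using continuous_on_lincomb[of B "{a..b}" c] contB by (intro continuous_intros) auto
  have "L c0 \<noteq> 0"
  proof
    assume "L c0 = 0"
    then have "\<forall>x\<in>{a..b}. lincomb B c0 x = 0"
      using integral_eq_0_iff[OF contl[of c0] \<open>a < b\<close>] by (simp add: L_def)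
    moreover have "lincomb B c0 x = 0" if "x \<notin> {a..b}" for x
      unfolding lincomb_def using B(3) that
      by (intro sum.neutral) (auto simp: cont_space_def)
    ultimately have "lincomb B c0 = 0" by (auto simp: fun_eq_iff)
    then have "\<forall>u\<in>B. c0 u = 0" using lincomb_eq_0D[OF B(1,2)] by blast
    then show False using c0(1) by (simp add: coeff_sphere_def)
  qed
  moreover have "L c0 \<ge> 0" unfolding L_def by (intro integral_nonneg integrable_continuous_real contl) auto
  ultimately have "L c0 > 0" by simp
  moreover have "L c0 * (\<Sum>u\<in>B. \<bar>c u\<bar>) \<le> L c" for c
  proof (cases "\<exists>u\<in>B. c u \<noteq> 0")
    case True
    obtain s d where sd: "s > 0" "d \<in> coeff_sphere B" "s = (\<Sum>u\<in>B. \<bar>c u\<bar>)"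
      "\<And>x. lincomb B c x = s * lincomb B d x" using lincomb_normalize[OF B(1) True] by metis
    have "L c = s * L d" unfolding L_def using sd by (simp add: abs_mult)
    then show ?thesis using sd c0(2)[OF sd(2)] by (simp add: mult.commute mult_left_mono)
  next
    case False
    then show ?thesis
      by (auto simp: L_def lincomb_def)
  qed
  ultimately show thesis using that unfolding L_def by blast
qed

text \<open>The integral is a continuous function of the coefficients, and it tends to infinity with them,
  because \<open>G\<close> grows at least linearly and the \<open>L\<^sup>1\<close> norm dominates the coefficients. So
  minimizing over a sufficiently large compact box is enough.\<close>
lemma exists_minimizer:
  fixes G f :: "real \<Rightarrow> real"
  assumes ab: "a < b"
    and G: "convex_on UNIV G" "G 0 = 0" "\<And>x. x \<noteq> 0 \<Longrightarrow> G x > 0"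
    and f: "continuous_on {a..b} f"
    and B: "finite B" "independent B" "B \<subseteq> cont_space a b"
  shows "\<exists>P\<in>span B. \<forall>Q\<in>span B. integral {a..b} (\<lambda>x. G (f x - P x))
           \<le> integral {a..b} (\<lambda>x. G (f x - Q x))"
proof -
  define J where "J c = integral {a..b} (\<lambda>x. G (f x - lincomb B c x))" for c
  have contB: "continuous_on {a..b} u" if "u \<in> B" for u
    using B(3) that by (auto simp: cont_space_def)
  note contG = convex_on_UNIV_continuous[OF G(1)]
  have contJ: "continuous_on A J" for A
    unfolding J_def by (rule continuous_integral_functional[OF contG f contB])
  obtain \<kappa> where \<kappa>: "\<kappa> > 0" "\<And>t. G t \<ge> \<kappa> * (\<bar>t\<bar> - 1)"
    using convex_on_linear_growth[OF G] by blast
  obtain m where m: "m > 0"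
    "\<And>c. m * (\<Sum>u\<in>B. \<bar>c u\<bar>) \<le> integral {a..b} (\<lambda>x. \<bar>lincomb B c x\<bar>)"
    using L1_norm_lower_bound[OF ab B] by blast
  have contl: "continuous_on {a..b} (lincomb B c)" for c
    using continuous_on_lincomb contB by blast
  have coercive: "J c \<ge> \<kappa> * (m * (\<Sum>u\<in>B. \<bar>c u\<bar>) - integral {a..b} (\<lambda>x. \<bar>f x\<bar> + 1))" for c
  proof -
    have int: "(\<lambda>x. G (f x - lincomb B c x)) integrable_on {a..b}"
      "(\<lambda>x. \<bar>lincomb B c x\<bar>) integrable_on {a..b}" "(\<lambda>x. \<bar>f x\<bar> + 1) integrable_on {a..b}"
      by (intro integrable_continuous_real continuous_on_compose2[OF contG[of UNIV]]
            continuous_intros f contl; simp)+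
    have "\<kappa> * (m * (\<Sum>u\<in>B. \<bar>c u\<bar>) - integral {a..b} (\<lambda>x. \<bar>f x\<bar> + 1))
        \<le> \<kappa> * (integral {a..b} (\<lambda>x. \<bar>lincomb B c x\<bar>) - integral {a..b} (\<lambda>x. \<bar>f x\<bar> + 1))"
      using m(2)[of c] \<kappa>(1) by (intro mult_left_mono) auto
    also have "\<dots> = integral {a..b} (\<lambda>x. \<kappa> * (\<bar>lincomb B c x\<bar> - (\<bar>f x\<bar> + 1)))"
      using int by (simp only: integral_mult_right integral_diff)
    also have "\<dots> \<le> J c"
      unfolding J_def
    proof (rule integral_le)
      show "(\<lambda>x. \<kappa> * (\<bar>lincomb B c x\<bar> - (\<bar>f x\<bar> + 1))) integrable_on {a..b}"
        by (intro integrable_on_mult_right integrable_diff int)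
      fix x
      have "\<kappa> * (\<bar>lincomb B c x\<bar> - (\<bar>f x\<bar> + 1)) \<le> \<kappa> * (\<bar>f x - lincomb B c x\<bar> - 1)"
        using \<kappa>(1) by (intro mult_left_mono) auto
      also have "\<dots> \<le> G (f x - lincomb B c x)" by (rule \<kappa>(2))
      finally show "\<kappa> * (\<bar>lincomb B c x\<bar> - (\<bar>f x\<bar> + 1)) \<le> G (f x - lincomb B c x)" .
    qed (rule int)
    finally show ?thesis .
  qed
  define F where "F = integral {a..b} (\<lambda>x. \<bar>f x\<bar> + 1)"
  \<comment> \<open>Outside the box of this radius the coercivity bound is at least the value at the zero element.\<close>
  define r where "r = max 0 ((J (\<lambda>_. 0) / \<kappa> + F) / m)"
  have "(\<lambda>_. 0) \<in> coeff_box B r" by (auto simp: coeff_box_def r_def)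
  then obtain c0 where c0: "c0 \<in> coeff_box B r" "\<And>d. d \<in> coeff_box B r \<Longrightarrow> J c0 \<le> J d"
    using continuous_attains_inf[OF compact_coeff_box _ contJ] by blast
  have "J c0 \<le> J d" for d
  proof (cases "\<forall>u\<in>B. \<bar>d u\<bar> \<le> r")
    case True
    define d' where "d' u = (if u \<in> B then d u else 0)" for u
    have "d' \<in> coeff_box B r" using True by (auto simp: coeff_box_def d'_def abs_le_iff minus_le_iff)
    moreover have "J d' = J d" unfolding J_def by (subst lincomb_cong[of B d' d]) (auto simp: d'_def)
    ultimately show ?thesis using c0(2) by metis
  next
    case False
    then obtain u where u: "u \<in> B" "\<bar>d u\<bar> > r" by auto
    then have "(\<Sum>u\<in>B. \<bar>d u\<bar>) > r"
      using member_le_sum[of u B "\<lambda>u. \<bar>d u\<bar>"] B(1) by auto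
    then have "m * (\<Sum>u\<in>B. \<bar>d u\<bar>) \<ge> J (\<lambda>_. 0) / \<kappa> + F"
      using m(1) by (simp add: r_def field_simps)
    then have "J (\<lambda>_. 0) \<le> \<kappa> * (m * (\<Sum>u\<in>B. \<bar>d u\<bar>) - F)"
      using \<kappa>(1) by (simp add: field_simps)
    also have "\<dots> \<le> J d" using coercive[of d] by (simp add: F_def)
    finally show ?thesis using c0(2)[OF \<open>(\<lambda>_. 0) \<in> coeff_box B r\<close>] by linarith
  qed
  then show ?thesis
    unfolding span_eq_range_lincomb[OF B(1)] J_def by blast
qed

section \<open>Sign changes in a Tchebycheff space\<close>

lemma tchebycheff_nonzero_vanishing_on:
  assumes "tchebycheff_space a b n S" "finite Z" "card Z < n"
  obtains g where "g \<in> S" "g \<noteq> 0" "\<And>z. z \<in> Z \<Longrightarrow> g z = 0"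
  using assms span_nonzero_vanishing_on[of _ Z] unfolding tchebycheff_space_def by metis

lemma tchebycheff_eq_0:
  assumes "tchebycheff_space a b n S" "0 < n" "g \<in> S"
    and "Z \<subseteq> {a..b}" "n \<le> card Z" "\<And>z. z \<in> Z \<Longrightarrow> g z = 0"
  shows "g = 0"
proof (rule ccontr)
  assume "g \<noteq> 0"
  then have *: "finite {x \<in> {a..b}. g x = 0}" "card {x \<in> {a..b}. g x = 0} \<le> n - 1"
    using assms(1,3) by (auto simp: tchebycheff_space_def)
  have "card Z \<le> card {x \<in> {a..b}. g x = 0}"
    using assms by (intro card_mono *) auto
  then show False using * assms by simp
qed

lemma tchebycheff_subspace: "tchebycheff_space a b n S \<Longrightarrow> subspace S"
  by (simp add: tchebycheff_space_def)

lemma tchebycheff_continuous: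
  "tchebycheff_space a b n S \<Longrightarrow> g \<in> S \<Longrightarrow> continuous_on {a..b} g"
  by (auto simp: tchebycheff_space_def cont_space_def)

text \<open>For a continuous
  function with isolated zeros, the interior points where this fails are exactly the zeros with a
  change of sign. The neighbourhoods are relative to \<open>[a,b]\<close>, so that endpoints are covered.\<close>
definition locally_signed :: "(real \<Rightarrow> real) \<Rightarrow> real \<Rightarrow> real \<Rightarrow> real \<Rightarrow> bool"
  where "locally_signed h a b x \<longleftrightarrow> (\<exists>\<sigma>\<in>{-1,1}. \<exists>\<eta>>0. \<forall>t\<in>{a..b}. \<bar>t - x\<bar> < \<eta> \<longrightarrow> 0 \<le> \<sigma> * h t)"

lemma locally_signed_mult:
  assumes "locally_signed g a b x" "locally_signed h a b x"
  shows "locally_signed (\<lambda>t. g t * h t) a b x"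
proof -
  obtain s \<eta> where 1: "s \<in> {-1,1}" "\<eta> > 0" "\<And>t. t \<in> {a..b} \<Longrightarrow> \<bar>t - x\<bar> < \<eta> \<Longrightarrow> 0 \<le> s * g t"
    using assms(1) unfolding locally_signed_def by blast
  obtain r \<theta> where 2: "r \<in> {-1,1}" "\<theta> > 0" "\<And>t. t \<in> {a..b} \<Longrightarrow> \<bar>t - x\<bar> < \<theta> \<Longrightarrow> 0 \<le> r * h t"
    using assms(2) unfolding locally_signed_def by blast
  have "0 \<le> s * r * (g t * h t)" if "t \<in> {a..b}" "\<bar>t - x\<bar> < min \<eta> \<theta>" for t
    using mult_nonneg_nonneg[OF 1(3)[of t] 2(3)[of t]] that by (simp add: mult_ac)
  moreover have "s * r \<in> {-1,1}" "min \<eta> \<theta> > 0" using 1 2 by auto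
  ultimately show ?thesis unfolding locally_signed_def by blast
qed

lemma locally_signed_subinterval:
  assumes "locally_signed h a b x" "c \<le> b"
  shows "locally_signed h a c x"
proof -
  obtain s \<eta> where "s \<in> {-1,1}" "\<eta> > 0" "\<forall>t\<in>{a..b}. \<bar>t - x\<bar> < \<eta> \<longrightarrow> 0 \<le> s * h t"
    using assms(1) unfolding locally_signed_def by blast
  moreover from this have "\<forall>t\<in>{a..c}. \<bar>t - x\<bar> < \<eta> \<longrightarrow> 0 \<le> s * h t" using assms(2) by auto
  ultimately show ?thesis unfolding locally_signed_def by blast
qed

lemma constant_sign_if_nonzero:
  fixes h :: "real \<Rightarrow> real"
  assumes "connected I" "continuous_on I h" "\<And>x. x \<in> I \<Longrightarrow> h x \<noteq> 0"
  obtains s where "s \<in> {-1,1::real}" "\<And>x. x \<in> I \<Longrightarrow> 0 < s * h x"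
proof (cases "\<exists>p\<in>I. h p > 0")
  case True
  then obtain p where p: "p \<in> I" "h p > 0" by auto
  have "0 < h x" if "x \<in> I" for x
  proof (rule ccontr)
    assume "\<not> 0 < h x"
    then have "0 \<in> h ` I"
      using connectedD_interval[OF connected_continuous_image[OF assms(2,1)], of "h x" "h p" 0] p that
      by auto
    then show False using assms(3) by force
  qed
  then show thesis using that[of 1] by auto
next
  case False
  then have "h x < 0" if "x \<in> I" for x using assms(3)[OF that] that by (meson linorder_neqE_linordered_idom)
  then show thesis using that[of "-1"] by auto
qed

lemma locally_signed_nonzero:
  assumes "continuous_on {a..b} h" "x \<in> {a..b}" "h x \<noteq> 0"
  shows "locally_signed h a b x"
proof -
  obtain d where d: "d > 0" "\<And>t. t \<in> {a..b} \<Longrightarrow> dist t x < d \<Longrightarrow> dist (h t) (h x) < \<bar>h x\<bar>"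
    using assms unfolding continuous_on_iff by (metis zero_less_abs_iff)
  have "0 \<le> sgn (h x) * h t" if "t \<in> {a..b}" "\<bar>t - x\<bar> < d" for t
    using d(2)[of t] that by (auto simp: dist_real_def sgn_if split: if_splits)
  moreover have "sgn (h x) \<in> {-1,1}" using assms(3) by (auto simp: sgn_if)
  ultimately show ?thesis unfolding locally_signed_def using d(1) by blast
qed

lemma isolating_radius:
  fixes x :: real
  assumes "finite Z" "0 < r"
  obtains \<eta> where "0 < \<eta>" "\<eta> < r" "\<And>z. z \<in> Z \<Longrightarrow> z \<noteq> x \<Longrightarrow> \<eta> < \<bar>z - x\<bar>"
proof -
  obtain d where d: "d > 0" "\<And>z. z \<in> Z \<Longrightarrow> z \<noteq> x \<Longrightarrow> d \<le> dist x z"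
    using finite_set_avoid[OF assms(1), of x] by blast
  show thesis
  proof (rule that[of "min d r / 2"])
    fix z assume "z \<in> Z" "z \<noteq> x"
    then show "min d r / 2 < \<bar>z - x\<bar>" using d(2)[of z] d(1) unfolding dist_real_def by linarith
  qed (use d assms in auto)
qed

lemma locally_signed_left_endpoint:
  assumes "a < b" "continuous_on {a..b} h" "finite {x \<in> {a..b}. h x = 0}"
  shows "locally_signed h a b a"
proof (cases "h a = 0")
  case False
  then show ?thesis using assms by (intro locally_signed_nonzero) auto
next
  case True
  obtain \<eta> where \<eta>: "0 < \<eta>" "\<eta> < b - a" "\<And>z. z \<in> {x \<in> {a..b}. h x = 0} \<Longrightarrow> z \<noteq> a \<Longrightarrow> \<eta> < \<bar>z - a\<bar>"
    using isolating_radius[OF assms(3), of "b - a" a] assms(1) by auto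
  have "h t \<noteq> 0" if "t \<in> {a<..<a+\<eta>}" for t using \<eta>(3)[of t] that \<eta>(2) by auto
  moreover have "continuous_on {a<..<a+\<eta>} h"
    using \<eta>(2) by (intro continuous_on_subset[OF assms(2)]) auto
  ultimately obtain s where s: "s \<in> {-1,1}" "\<And>t. t \<in> {a<..<a+\<eta>} \<Longrightarrow> 0 < s * h t"
    using constant_sign_if_nonzero[of "{a<..<a+\<eta>}" h] by auto
  have "0 \<le> s * h t" if "t \<in> {a..b}" "\<bar>t - a\<bar> < \<eta>" for t
  proof (cases "t = a")
    case False
    then show ?thesis using s(2)[of t] that by auto
  qed (use True in simp)
  then show ?thesis unfolding locally_signed_def using s(1) \<eta>(1) by blast
qed

text \<open>To the left and to the right of an isolated zero the sign is constant. If the two signs differ,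
  then up to a global sign \<open>h t\<close> has the sign of \<open>t - y\<close>; in this form the sign changes of two
  functions at the same point visibly cancel in their product.\<close>
lemma sides_of_isolated_zero:
  assumes "a < y" "y < b" "continuous_on {a..b} h" "finite {x \<in> {a..b}. h x = 0}"
    "h y = 0" "\<not> locally_signed h a b y"
  obtains \<eta> s where "0 < \<eta>" "s \<in> {-1,1}"
    "\<And>t. t \<in> {a..b} \<Longrightarrow> \<bar>t - y\<bar> < \<eta> \<Longrightarrow> 0 \<le> s * (h t * (t - y))"
proof -
  obtain \<eta> where \<eta>: "0 < \<eta>" "\<eta> < min (y - a) (b - y)"
    "\<And>z. z \<in> {x \<in> {a..b}. h x = 0} \<Longrightarrow> z \<noteq> y \<Longrightarrow> \<eta> < \<bar>z - y\<bar>"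
    using isolating_radius[OF assms(4), of "min (y - a) (b - y)" y] assms(1,2) by auto
  have "h t \<noteq> 0" if "t \<in> {y<..<y+\<eta>}" for t using \<eta>(3)[of t] that \<eta>(2) by auto
  moreover have "continuous_on {y<..<y+\<eta>} h"
    using \<eta>(2) assms(1,2) by (intro continuous_on_subset[OF assms(3)]) auto
  ultimately obtain r where r: "r \<in> {-1,1}" "\<And>t. t \<in> {y<..<y+\<eta>} \<Longrightarrow> 0 < r * h t"
    using constant_sign_if_nonzero[of "{y<..<y+\<eta>}" h] by auto
  have "h t \<noteq> 0" if "t \<in> {y-\<eta><..<y}" for t using \<eta>(3)[of t] that \<eta>(2) by auto
  moreover have "continuous_on {y-\<eta><..<y} h"
    using \<eta>(2) assms(1,2) by (intro continuous_on_subset[OF assms(3)]) auto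
  ultimately obtain l where l: "l \<in> {-1,1}" "\<And>t. t \<in> {y-\<eta><..<y} \<Longrightarrow> 0 < l * h t"
    using constant_sign_if_nonzero[of "{y-\<eta><..<y}" h] by auto
  have "l \<noteq> r"
  proof
    assume "l = r"
    have "0 \<le> r * h t" if "t \<in> {a..b}" "\<bar>t - y\<bar> < \<eta>" for t
      using r(2)[of t] l(2)[of t] \<open>l = r\<close> that assms(5)
      by (cases t y rule: linorder_cases) auto
    then show False using assms(6) r(1) \<eta>(1) unfolding locally_signed_def by blast
  qed
  then have lr: "l = - r" using l(1) r(1) by auto
  show thesis
  proof (rule that[OF \<eta>(1) r(1)])
    fix t assume t: "t \<in> {a..b}" "\<bar>t - y\<bar> < \<eta>"
    show "0 \<le> r * (h t * (t - y))"
    proof (cases t y rule: linorder_cases)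
      case less
      then have "0 < l * h t" using l(2)[of t] t by auto
      then have "0 \<le> (l * h t) * (y - t)" using less by (intro mult_nonneg_nonneg less_imp_le) auto
      then show ?thesis using lr by (simp add: algebra_simps)
    next
      case greater
      then have "0 < r * h t" using r(2)[of t] t by auto
      then have "0 \<le> (r * h t) * (t - y)" using greater by simp
      then show ?thesis by (simp add: algebra_simps)
    qed simp
  qed
qed

lemma locally_signed_mult_sign_changes:
  assumes y: "a < y" "y < b"
    and g: "continuous_on {a..b} g" "finite {x \<in> {a..b}. g x = 0}" "g y = 0" "\<not> locally_signed g a b y"
    and h: "continuous_on {a..b} h" "finite {x \<in> {a..b}. h x = 0}" "h y = 0" "\<not> locally_signed h a b y"
  shows "locally_signed (\<lambda>t. g t * h t) a b y"
proof -
  obtain s \<eta> where 1: "0 < \<eta>" "s \<in> {-1,1}"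
    "\<And>t. t \<in> {a..b} \<Longrightarrow> \<bar>t - y\<bar> < \<eta> \<Longrightarrow> 0 \<le> s * (g t * (t - y))"
    using sides_of_isolated_zero[OF y g] by metis
  obtain r \<theta> where 2: "0 < \<theta>" "r \<in> {-1,1}"
    "\<And>t. t \<in> {a..b} \<Longrightarrow> \<bar>t - y\<bar> < \<theta> \<Longrightarrow> 0 \<le> r * (h t * (t - y))"
    using sides_of_isolated_zero[OF y h] by metis
  have "0 \<le> s * r * (g t * h t)" if t: "t \<in> {a..b}" "\<bar>t - y\<bar> < min \<eta> \<theta>" for t
  proof (cases "t = y")
    case False
    have "0 \<le> (s * (g t * (t - y))) * (r * (h t * (t - y)))"
      by (intro mult_nonneg_nonneg 1(3) 2(3)) (use t in auto)
    also have "\<dots> = (s * r * (g t * h t)) * (t - y)^2" by (simp add: power2_eq_square mult_ac)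
    finally show ?thesis using False by (simp add: zero_le_mult_iff)
  qed (simp add: g)
  moreover have "s * r \<in> {-1,1}" "min \<eta> \<theta> > 0" using 1 2 by auto
  ultimately show ?thesis unfolding locally_signed_def by blast
qed

text \<open>The points around which \<open>h \<ge> 0\<close> and those around which \<open>h \<le> 0\<close> form two open sets that cover
  the interval. At a common point \<open>h\<close> would vanish on a whole interval, so they are disjoint and, by
  connectedness, one of them contains everything.\<close>
lemma signed_if_locally_signed:
  assumes "a < b" "finite {x \<in> {a..b}. h x = 0}" "\<And>x. x \<in> {a..b} \<Longrightarrow> locally_signed h a b x"
  obtains s where "s \<in> {-1,1}" "\<And>x. x \<in> {a..b} \<Longrightarrow> 0 \<le> s * h x"
proof -
  define A where "A s = {x. \<exists>\<eta>>0. \<forall>t\<in>{a..b}. \<bar>t - x\<bar> < \<eta> \<longrightarrow> 0 \<le> s * h t}" for s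
  have openA: "open (A s)" for s
    unfolding open_dist
  proof
    fix x assume "x \<in> A s"
    then obtain \<eta> where \<eta>: "\<eta> > 0" "\<And>t. t\<in>{a..b} \<Longrightarrow> \<bar>t - x\<bar> < \<eta> \<Longrightarrow> 0 \<le> s * h t"
      unfolding A_def by blast
    have "z \<in> A s" if "dist z x < \<eta> / 2" for z
      unfolding A_def mem_Collect_eq
    proof (intro exI[of _ "\<eta> / 2"] conjI ballI impI)
      fix t assume "t \<in> {a..b}" "\<bar>t - z\<bar> < \<eta> / 2"
      moreover from this have "\<bar>t - x\<bar> < \<eta>" using that unfolding dist_real_def by linarith
      ultimately show "0 \<le> s * h t" using \<eta>(2) by blast
    qed (use \<eta> in simp)
    then show "\<exists>e>0. \<forall>y. dist y x < e \<longrightarrow> y \<in> A s" using \<eta>(1) by (intro exI[of _ "\<eta>/2"]) auto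
  qed
  have "A 1 \<inter> A (-1) \<inter> {a..b} = {}"
  proof (rule equals0I)
    fix x assume x: "x \<in> A 1 \<inter> A (-1) \<inter> {a..b}"
    then obtain \<eta> where 1: "\<eta> > 0" "\<And>t. t\<in>{a..b} \<Longrightarrow> \<bar>t - x\<bar> < \<eta> \<Longrightarrow> 0 \<le> 1 * h t"
      unfolding A_def by blast
    from x obtain \<theta> where 2: "\<theta> > 0" "\<And>t. t\<in>{a..b} \<Longrightarrow> \<bar>t - x\<bar> < \<theta> \<Longrightarrow> 0 \<le> -1 * h t"
      unfolding A_def by blast
    have "{max a (x - min \<eta> \<theta>)<..<min b (x + min \<eta> \<theta>)} \<subseteq> {x \<in> {a..b}. h x = 0}"
    proof
      fix t assume "t \<in> {max a (x - min \<eta> \<theta>)<..<min b (x + min \<eta> \<theta>)}"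
      then have t: "t \<in> {a..b}" "\<bar>t - x\<bar> < \<eta>" "\<bar>t - x\<bar> < \<theta>" by (auto simp: abs_less_iff)
      then show "t \<in> {x \<in> {a..b}. h x = 0}" using 1(2)[OF t(1,2)] 2(2)[OF t(1,3)] by simp
    qed
    moreover have "max a (x - min \<eta> \<theta>) < min b (x + min \<eta> \<theta>)"
      using x 1(1) 2(1) assms(1) by auto
    ultimately show False using assms(2) infinite_Ioo finite_subset by blast
  qed
  moreover have "{a..b} \<subseteq> A 1 \<union> A (-1)"
    using assms(3) unfolding locally_signed_def A_def by fast
  ultimately have "A 1 \<inter> {a..b} = {} \<or> A (-1) \<inter> {a..b} = {}"
    using connectedD[OF connected_Icc openA openA, of 1 "-1" a b] by auto
  then have "{a..b} \<subseteq> A (-1) \<or> {a..b} \<subseteq> A 1" using \<open>{a..b} \<subseteq> A 1 \<union> A (-1)\<close> by auto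
  moreover have "0 \<le> s * h x" if "x \<in> A s" "x \<in> {a..b}" for s x
    using that unfolding A_def by force
  ultimately show thesis using that[of 1] that[of "-1"] by blast
qed

text \<open>A zero without change of sign counts twice: subtracting a small multiple of a function \<open>g\<close> that is
  positive at \<open>y\<close> and vanishes at the other zeros of \<open>R\<close> splits \<open>y\<close> into two zeros. The difference
  then has \<open>n\<close> zeros, which a nonzero element of the space cannot have.\<close>
lemma tchebycheff_no_double_zero:
  assumes T: "tchebycheff_space a b n S" and R: "R \<in> S" "R \<noteq> 0"
    and card: "card {x \<in> {a..b}. R x = 0} = n - 1"
    and y: "a < y" "y < b" "R y = 0"
    and \<eta>0: "0 < \<eta>0" "\<And>t. t \<in> {a..b} \<Longrightarrow> \<bar>t - y\<bar> < \<eta>0 \<Longrightarrow> 0 \<le> R t"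
  shows False
proof -
  define Z where "Z = {x \<in> {a..b}. R x = 0}"
  have finZ: "finite Z" using T R unfolding Z_def tchebycheff_space_def by auto
  have yZ: "y \<in> Z" using y by (auto simp: Z_def)
  then have cardZ: "card Z = n - 1" "0 < card Z"
    using finZ card unfolding Z_def[symmetric] by (metis, metis card_gt_0_iff empty_iff)
  then have n: "0 < n" by simp
  \<comment> \<open>The auxiliary zero \<open>p\<close> brings the number of prescribed zeros of \<open>g\<close> to \<open>n - 1\<close>, which forces \<open>g y \<noteq> 0\<close>.\<close>
  have "infinite {a..b}" using y by auto
  then obtain p where p: "p \<in> {a..b}" "p \<notin> Z" using finZ by (meson finite_subset subsetI)
  have "card (insert p (Z - {y})) = n - 1" using p finZ yZ cardZ by simp
  then have "card (insert p (Z - {y})) < n" using n by simp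
  then obtain g0 where g0: "g0 \<in> S" "g0 \<noteq> 0" "\<And>z. z \<in> insert p (Z - {y}) \<Longrightarrow> g0 z = 0"
    using tchebycheff_nonzero_vanishing_on[OF T] finZ by (metis finite_Diff finite_insert)
  have "g0 y \<noteq> 0"
  proof
    assume "g0 y = 0"
    then have "g0 = 0" using g0 p cardZ finZ n
      by (intro tchebycheff_eq_0[OF T n g0(1), of "insert p Z"]) (auto simp: Z_def)
    then show False using g0 by simp
  qed
  define g where "g = (if g0 y > 0 then g0 else - g0)"
  have g: "g \<in> S" "g y > 0" "\<And>z. z \<in> Z \<Longrightarrow> z \<noteq> y \<Longrightarrow> g z = 0"
    using g0 \<open>g0 y \<noteq> 0\<close> subspace_neg[OF tchebycheff_subspace[OF T]] by (auto simp: g_def)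
  obtain \<eta> where \<eta>: "0 < \<eta>" "\<eta> < min \<eta>0 (min (y - a) (b - y))"
    "\<And>z. z \<in> Z \<Longrightarrow> z \<noteq> y \<Longrightarrow> \<eta> < \<bar>z - y\<bar>"
    using isolating_radius[OF finZ, of "min \<eta>0 (min (y - a) (b - y))" y] y \<eta>0(1) by auto
  have Rpos: "R (y - \<eta>) > 0" "R (y + \<eta>) > 0"
    using \<eta>0(2)[of "y - \<eta>"] \<eta>0(2)[of "y + \<eta>"] \<eta>(3)[of "y - \<eta>"] \<eta>(3)[of "y + \<eta>"] \<eta>(1,2)
    by (auto simp: Z_def less_le)
  \<comment> \<open>The factor \<open>\<delta>\<close> is small enough that \<open>R - \<delta> g\<close> stays positive at \<open>y - \<eta>\<close> and \<open>y + \<eta>\<close>.\<close>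
  define M where "M = 1 + max \<bar>g (y - \<eta>)\<bar> \<bar>g (y + \<eta>)\<bar>"
  define m where "m = min (R (y - \<eta>)) (R (y + \<eta>))"
  define \<delta> where "\<delta> = m / M"
  have M: "M > 0" "g (y - \<eta>) < M" "g (y + \<eta>) < M" unfolding M_def by auto
  have m: "m > 0" "m \<le> R (y - \<eta>)" "m \<le> R (y + \<eta>)" using Rpos by (auto simp: m_def)
  have \<delta>: "\<delta> > 0" using m M by (simp add: \<delta>_def)
  have "\<delta> * g (y - \<eta>) < \<delta> * M" "\<delta> * g (y + \<eta>) < \<delta> * M" using M \<delta> by auto
  moreover have "\<delta> * M = m" using M by (simp add: \<delta>_def)
  ultimately have small: "\<delta> * g (y - \<eta>) < R (y - \<eta>)" "\<delta> * g (y + \<eta>) < R (y + \<eta>)" using m by auto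
  define h where "h = R - \<delta> *\<^sub>R g"
  have hS: "h \<in> S" unfolding h_def
    using tchebycheff_subspace[OF T] R g by (intro subspace_diff subspace_scale)
  have hx: "h x = R x - \<delta> * g x" for x by (simp add: h_def scaleR_fun_def)
  have hy: "h y < 0" using g \<delta> y by (simp add: hx)
  have hpm: "h (y - \<eta>) > 0" "h (y + \<eta>) > 0" using small by (auto simp: hx)
  have conth: "continuous_on {u..v} h" if "a \<le> u" "v \<le> b" for u v
    using that by (intro continuous_on_subset[OF tchebycheff_continuous[OF T hS]]) auto
  obtain z1 where z1: "y - \<eta> \<le> z1" "z1 \<le> y" "h z1 = 0"
    using IVT2'[of h y 0 "y - \<eta>"] hy hpm conth[of "y - \<eta>" y] \<eta> y by auto
  obtain z2 where z2: "y \<le> z2" "z2 \<le> y + \<eta>" "h z2 = 0"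
    using IVT'[of h y 0 "y + \<eta>"] hy hpm conth[of y "y + \<eta>"] \<eta> y by auto
  have ne: "z1 \<noteq> y" "z2 \<noteq> y" using z1 z2 hy by auto
  then have "z1 < y" "y < z2" using z1 z2 by auto
  moreover have "z1 \<notin> Z" "z2 \<notin> Z" using \<eta>(3)[of z1] \<eta>(3)[of z2] ne z1 z2 by auto
  ultimately have "card (insert z1 (insert z2 (Z - {y}))) = Suc (Suc (card Z - 1))"
    using finZ yZ by (simp add: card_Diff_singleton)
  then have "n \<le> card (insert z1 (insert z2 (Z - {y})))" using cardZ by simp
  moreover have "insert z1 (insert z2 (Z - {y})) \<subseteq> {a..b}"
    using z1 z2 \<eta> y by (auto simp: Z_def)
  moreover have "h z = 0" if "z \<in> insert z1 (insert z2 (Z - {y}))" for z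
    using that z1 z2 g(3) by (auto simp: hx Z_def)
  ultimately have "h = 0" using tchebycheff_eq_0[OF T n hS] by blast
  then show False using hy by simp
qed

lemma tchebycheff_sign_change:
  assumes T: "tchebycheff_space a b n S" and R: "R \<in> S" "R \<noteq> 0"
    and card: "card {x \<in> {a..b}. R x = 0} = n - 1"
    and y: "a < y" "y < b" "R y = 0"
  shows "\<not> locally_signed R a b y"
proof
  assume "locally_signed R a b y"
  then obtain s \<eta> where s: "s \<in> {-1,1}" "\<eta> > 0" "\<And>t. t \<in> {a..b} \<Longrightarrow> \<bar>t - y\<bar> < \<eta> \<Longrightarrow> 0 \<le> s * R t"
    unfolding locally_signed_def by blast
  from s(1) consider "s = 1" | "s = -1" by auto
  then show False
  proof cases
    case 1
    then show ?thesis using tchebycheff_no_double_zero[OF T R card y s(2)] s(3) by simp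
  next
    case 2
    show ?thesis
      using tchebycheff_no_double_zero[OF T, of "-R" y \<eta>] R card y s 2
        subspace_neg[OF tchebycheff_subspace[OF T] R(1)]
      by simp
  qed
qed

text \<open>Prescribe the zeros of \<open>R\<close> at the sign changes of \<open>e\<close>. They may be fewer than \<open>n - 1\<close>; the
  missing ones are placed between \<open>X\<close> and \<open>b\<close>, where they do no harm. With \<open>n - 1\<close> zeros in total, each
  interior one is a sign change of \<open>R\<close>, so to the left of the added zeros \<open>e\<close> and \<open>R\<close> change sign
  together and their product has a constant sign.\<close>
lemma sign_matching_on_finite:
  assumes ab: "a < b" and T: "tchebycheff_space a b n S" and n: "0 < n"
    and e: "continuous_on {a..b} e" "finite {x \<in> {a..b}. e x = 0}" "card {x \<in> {a..b}. e x = 0} \<le> n - 1"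
    and X: "finite X" "X \<subseteq> {a..<b}"
  obtains R where "R \<in> S" "R \<noteq> 0" "\<And>x. x \<in> X \<Longrightarrow> 0 \<le> e x * R x"
proof -
  define Y where "Y = {y \<in> {a<..<b}. \<not> locally_signed e a b y}"
  have Y0: "e y = 0" if "y \<in> Y" for y
    using that locally_signed_nonzero[OF e(1), of y] by (force simp: Y_def)
  then have Ysub: "Y \<subseteq> {x \<in> {a..b}. e x = 0}" by (auto simp: Y_def)
  then have finY: "finite Y" using e(2) by (rule finite_subset)
  have cardY: "card Y \<le> n - 1" using card_mono[OF e(2) Ysub] e(3) by simp
  define m where "m = Max (insert a (X \<union> Y))"
  have m: "m < b" "a \<le> m" "\<And>x. x \<in> X \<union> Y \<Longrightarrow> x \<le> m"
    unfolding m_def using X finY ab by (auto simp: Y_def)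
  define c where "c = (m + b) / 2"
  have c: "m < c" "c < b" "a < c" using m by (auto simp: c_def)
  obtain E where E: "finite E" "card E = n - 1 - card Y" "E \<subseteq> {c<..<b}"
    using infinite_arbitrarily_large[OF infinite_Ioo[OF c(2)]] by metis
  have disj: "Y \<inter> E = {}" using E(3) m(3) c(1) by force
  have cardYE: "card (Y \<union> E) = n - 1" using card_Un_disjoint[OF finY E(1) disj] E(2) cardY by simp
  obtain R where R: "R \<in> S" "R \<noteq> 0" "\<And>z. z \<in> Y \<union> E \<Longrightarrow> R z = 0"
    by (rule tchebycheff_nonzero_vanishing_on[OF T, of "Y \<union> E"])
       (use finY E(1) cardYE n in auto)
  have finR: "finite {x \<in> {a..b}. R x = 0}" and cardR: "card {x \<in> {a..b}. R x = 0} \<le> n - 1"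
    using T R unfolding tchebycheff_space_def by auto
  have zeros: "{x \<in> {a..b}. R x = 0} = Y \<union> E"
  proof (rule sym, rule card_seteq[OF finR])
    show "Y \<union> E \<subseteq> {x \<in> {a..b}. R x = 0}" using R(3) E(3) c by (auto simp: Y_def)
  qed (use cardR cardYE in auto)
  have contR: "continuous_on {a..b} R" using tchebycheff_continuous[OF T R(1)] .
  have signed: "locally_signed (\<lambda>t. e t * R t) a c x" if x: "x \<in> {a..c}" for x
  proof (rule locally_signed_subinterval)
    show "locally_signed (\<lambda>t. e t * R t) a b x"
    proof (cases "x \<in> Y")
      case True
      have "\<not> locally_signed R a b x"
        using tchebycheff_sign_change[OF T R(1,2)] zeros cardYE True R(3) by (auto simp: Y_def)
      then show ?thesis
        using True Y0 R(3) contR finR e(1,2)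
        by (intro locally_signed_mult_sign_changes) (auto simp: Y_def)
    next
      case False
      have "x \<in> {a..b}" using x c by auto
      moreover have "x \<notin> E" using x E(3) by force
      ultimately have "R x \<noteq> 0" using False zeros by blast
      then have "locally_signed R a b x" using contR \<open>x \<in> {a..b}\<close> by (intro locally_signed_nonzero)
      moreover have "locally_signed e a b x"
      proof (cases "x = a")
        case True
        then show ?thesis using locally_signed_left_endpoint[OF ab e(1,2)] by simp
      qed (use False x c in \<open>auto simp: Y_def\<close>)
      ultimately show ?thesis by (intro locally_signed_mult)
    qed
  qed (use c in simp)
  have "finite {x \<in> {a..c}. e x * R x = 0}"
    by (rule finite_subset[OF _ finite_UnI[OF e(2) finR]]) (use c in auto)
  then obtain s where s: "s \<in> {-1,1}" "\<And>x. x \<in> {a..c} \<Longrightarrow> 0 \<le> s * (e x * R x)"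
    using signed_if_locally_signed[OF c(3) _ signed] by metis
  show thesis
  proof (rule that[of "s *\<^sub>R R"])
    show "s *\<^sub>R R \<in> S" using tchebycheff_subspace[OF T] R(1) by (rule subspace_scale)
    show "s *\<^sub>R R \<noteq> 0" using s(1) R(2) by auto
    fix x assume "x \<in> X"
    then have "x \<in> {a..c}" using X(2) m(3)[of x] c(1) by auto
    then show "0 \<le> e x * (s *\<^sub>R R) x" using s(2)[of x] by (simp add: scaleR_fun_def mult_ac)
  qed
qed

text \<open>The finite case extends to all of \<open>[a,b)\<close> by compactness of the unit sphere of coefficients: each
  condition \<open>0 \<le> e x * R x\<close> is closed in the coefficients, and finitely many of them can be met together.\<close>
lemma sign_matching:
  assumes ab: "a < b" and T: "tchebycheff_space a b n S" and n: "0 < n"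
    and e: "continuous_on {a..b} e" "finite {x \<in> {a..b}. e x = 0}" "card {x \<in> {a..b}. e x = 0} \<le> n - 1"
  obtains R where "R \<in> S" "R \<noteq> 0" "\<And>x. x \<in> {a..<b} \<Longrightarrow> 0 \<le> e x * R x"
proof -
  obtain B where B: "finite B" "independent B" "span B = S"
    using T unfolding tchebycheff_space_def by blast
  define K where "K x = {c. 0 \<le> e x * lincomb B c x}" for x
  have "closed (K x)" for x
    unfolding K_def by (intro closed_Collect_le continuous_intros continuous_on_lincomb_coeff)
  moreover have "coeff_sphere B \<inter> (\<Inter>x\<in>X. K x) \<noteq> {}" if X: "finite X" "X \<subseteq> {a..<b}" for X
  proof -
    obtain R where R: "R \<in> S" "R \<noteq> 0" "\<And>x. x \<in> X \<Longrightarrow> 0 \<le> e x * R x"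
      using sign_matching_on_finite[OF assms X] by metis
    then obtain c where c: "R = lincomb B c" using B span_eq_range_lincomb by blast
    have "\<exists>u\<in>B. c u \<noteq> 0"
    proof (rule ccontr)
      assume "\<not> ?thesis"
      then have "R x = 0" for x by (simp add: c lincomb_def)
      then show False using R(2) by (auto simp: fun_eq_iff)
    qed
    then obtain s d where sd: "s > 0" "d \<in> coeff_sphere B" "\<And>x. lincomb B c x = s * lincomb B d x"
      using lincomb_normalize[OF B(1)] by metis
    have "d \<in> K x" if "x \<in> X" for x
    proof -
      have "0 \<le> s * (e x * lincomb B d x)" using R(3)[OF that] by (simp add: c sd(3) mult_ac)
      then show ?thesis using sd(1) by (simp add: K_def zero_le_mult_iff)
    qed
    then show ?thesis using sd(2) by blast
  qed
  ultimately have "coeff_sphere B \<inter> (\<Inter>x\<in>{a..<b}. K x) \<noteq> {}"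
    by (rule compact_imp_fip_image[OF compact_coeff_sphere[OF B(1)]])
  then obtain d where d: "d \<in> coeff_sphere B" "\<And>x. x \<in> {a..<b} \<Longrightarrow> 0 \<le> e x * lincomb B d x"
    unfolding K_def by blast
  show thesis
  proof (rule that[OF _ _ d(2)])
    show "lincomb B d \<in> S" using B span_eq_range_lincomb by blast
    show "lincomb B d \<noteq> 0"
    proof
      assume "lincomb B d = 0"
      then have "\<forall>u\<in>B. d u = 0" using lincomb_eq_0D[OF B(1,2)] by blast
      then show False using d(1) by (simp add: coeff_sphere_def)
    qed
  qed
qed

section \<open>Convexity of the integrand\<close>

text \<open>The value of \<open>\<phi>\<close> at \<open>0\<close> may be negative, but this affects a null set only; monotonicity bounds the
  integral over \<open>[x/2,x]\<close> below by \<open>x/2 * \<phi> (x/2)\<close>.\<close>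
lemma Psi_class_pos:
  assumes "\<Phi> \<in> Psi_class"
  shows "\<Phi> 0 = 0" "x > 0 \<Longrightarrow> \<Phi> x > 0"
proof -
  obtain \<phi> where \<phi>: "mono_on {0..} \<phi>" "\<And>t. t > 0 \<Longrightarrow> \<phi> t > 0"
    "\<And>x. x \<ge> 0 \<Longrightarrow> \<Phi> x = (LINT t:{0..x}|lebesgue. \<phi> t)"
    using assms unfolding Psi_class_def Im_class_def by auto
  have eq: "\<Phi> x = integral {0..x} \<phi>" and int: "\<phi> integrable_on {0..x}" if "x \<ge> 0" for x
  proof -
    have mono: "mono_on {0..x} \<phi>" using \<phi>(1) by (rule mono_on_subset) auto
    then show "\<phi> integrable_on {0..x}" by (rule integrable_on_mono_on)
    have "set_integrable lebesgue {0..x} \<phi>"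
      using integrable_mono_on[OF mono] by (simp add: integrable_restrict_space set_integrable_def)
    then show "\<Phi> x = integral {0..x} \<phi>"
      using \<phi>(3)[OF that] by (simp add: set_lebesgue_integral_eq_integral)
  qed
  show "\<Phi> 0 = 0" by (simp add: eq)
  show "\<Phi> x > 0" if x: "x > 0"
  proof -
    have i0: "\<phi> integrable_on {0..x}" using int x by simp
    have i1: "\<phi> integrable_on {0..x/2}" and i2: "\<phi> integrable_on {x/2..x}"
      using x by (auto intro: integrable_on_subinterval[OF i0])
    have "0 \<le> integral {0..x/2} (\<lambda>t. if t = 0 then 0 else \<phi> t)"
      using \<phi>(2) by (intro integral_nonneg integrable_spike[OF i1, of "{0}"]) (auto simp: less_imp_le)
    also have "\<dots> = integral {0..x/2} \<phi>"
      by (rule integral_spike[of "{0}"]) auto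
    finally have "0 \<le> integral {0..x/2} \<phi>" .
    moreover have "integral {x/2..x} (\<lambda>t. \<phi> (x/2)) \<le> integral {x/2..x} \<phi>"
      using x by (intro integral_le i2) (auto intro!: mono_onD[OF \<phi>(1)])
    then have "x/2 * \<phi> (x/2) \<le> integral {x/2..x} \<phi>" using x by simp
    moreover have "0 < x/2 * \<phi> (x/2)" using x \<phi>(2)[of "x/2"] by simp
    moreover have "integral {0..x/2} \<phi> + integral {x/2..x} \<phi> = integral {0..x} \<phi>"
      using x i0 by (intro Henstock_Kurzweil_Integration.integral_combine) auto
    ultimately show ?thesis using eq[of x] x by linarith
  qed
qed

text \<open>A convex function that is minimal at \<open>0\<close> is nondecreasing on the right of \<open>0\<close>, so composing it with the
  convex function \<open>\<bar>x\<bar>\<close> preserves convexity.\<close>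
lemma convex_on_even_extension:
  fixes \<Phi> :: "real \<Rightarrow> real"
  assumes \<Phi>: "convex_on {0..} \<Phi>" "\<Phi> 0 = 0" "\<And>x. x > 0 \<Longrightarrow> \<Phi> x > 0"
  shows "convex_on UNIV (\<lambda>x. \<Phi> \<bar>x\<bar>)"
proof (rule convex_onI)
  have mono: "\<Phi> x \<le> \<Phi> y" if "0 \<le> x" "x \<le> y" for x y
  proof (cases "y = 0")
    case False
    then have y: "y > 0" using that by simp
    have "\<Phi> ((1 - x / y) *\<^sub>R 0 + (x / y) *\<^sub>R y) \<le> (1 - x / y) * \<Phi> 0 + (x / y) * \<Phi> y"
      using that y by (intro convex_onD[OF \<Phi>(1)]) auto
    then have "\<Phi> x \<le> (x / y) * \<Phi> y" using y \<Phi>(2) by simp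
    also have "\<dots> \<le> 1 * \<Phi> y" using that y \<Phi>(3)[OF y] by (intro mult_right_mono) auto
    finally show ?thesis by simp
  qed (use that in simp)
  fix t x y :: real assume t: "0 < t" "t < 1"
  have "\<bar>(1 - t) * x + t * y\<bar> \<le> \<bar>(1 - t) * x\<bar> + \<bar>t * y\<bar>" by (rule abs_triangle_ineq)
  then have "\<bar>(1 - t) *\<^sub>R x + t *\<^sub>R y\<bar> \<le> (1 - t) *\<^sub>R \<bar>x\<bar> + t *\<^sub>R \<bar>y\<bar>"
    using t by (simp add: abs_mult)
  then have "\<Phi> \<bar>(1 - t) *\<^sub>R x + t *\<^sub>R y\<bar> \<le> \<Phi> ((1 - t) *\<^sub>R \<bar>x\<bar> + t *\<^sub>R \<bar>y\<bar>)"
    by (intro mono) auto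
  also have "\<dots> \<le> (1 - t) * \<Phi> \<bar>x\<bar> + t * \<Phi> \<bar>y\<bar>"
    using t by (intro convex_onD[OF \<Phi>(1)]) auto
  finally show "\<Phi> \<bar>(1 - t) *\<^sub>R x + t *\<^sub>R y\<bar> \<le> (1 - t) * \<Phi> \<bar>x\<bar> + t * \<Phi> \<bar>y\<bar>" .
qed auto

section \<open>Uniqueness of the minimizer\<close>

text \<open>If \<open>R\<close> has the sign of \<open>e\<close>, then moving from \<open>e\<close> towards \<open>e - s R\<close> decreases \<open>G\<close> at every point
  outside \<open>Z\<close> once \<open>s\<close> is small, but how small depends on the point. By convexity the difference
  quotients \<open>D i\<close> for \<open>s = 1 / (i + 1)\<close> decrease in \<open>i\<close>. Hence their negative parts
  have integrals bounded away from \<open>0\<close>, while their positive parts, dominated by the first one, tend to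
  \<open>0\<close> outside \<open>Z\<close> and so do their integrals.\<close>
lemma descent_direction:
  fixes G e R :: "real \<Rightarrow> real"
  assumes ab: "a < b"
    and G: "convex_on UNIV G" "G 0 = 0" "\<And>x. x \<noteq> 0 \<Longrightarrow> G x > 0"
    and e: "continuous_on {a..b} e" and R: "continuous_on {a..b} R"
    and Z: "finite Z" "\<And>x. x \<in> {a..b} \<Longrightarrow> x \<notin> Z \<Longrightarrow> 0 < e x * R x"
  shows "\<exists>s. integral {a..b} (\<lambda>x. G (e x - s * R x)) < integral {a..b} (\<lambda>x. G (e x))"
proof (rule ccontr)
  assume no: "\<not> ?thesis"
  define D where "D i x = real (Suc i) * (G (e x - R x / real (Suc i)) - G (e x))" for i x
  have contG: "continuous_on {a..b} (\<lambda>x. G (h x))" if "continuous_on {a..b} h" for h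
    using continuous_on_compose2[OF convex_on_UNIV_continuous[OF G(1), of UNIV] that] by simp
  have contD: "continuous_on {a..b} (D i)" for i
    unfolding D_def by (intro continuous_intros contG e R) auto
  have intmax: "(\<lambda>x. max (D i x) 0) integrable_on {a..b}"
    and intmin: "(\<lambda>x. min (D i x) 0) integrable_on {a..b}" for i
    by (intro integrable_continuous_real continuous_intros contD)+
  have D_nonneg: "0 \<le> integral {a..b} (D i)" for i
  proof -
    have "integral {a..b} (D i) = real (Suc i) *
        (integral {a..b} (\<lambda>x. G (e x - R x / real (Suc i))) - integral {a..b} (\<lambda>x. G (e x)))"
      unfolding D_def
      by (subst integral_diff[symmetric] integral_mult_right)+
         (auto intro!: integrable_continuous_real contG continuous_intros e R)
    moreover have "integral {a..b} (\<lambda>x. G (e x)) \<le> integral {a..b} (\<lambda>x. G (e x - R x / real (Suc i)))"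
      using no[unfolded not_ex not_less, rule_format, of "1 / real (Suc i)"] by simp
    ultimately show ?thesis by simp
  qed
  have antimono: "D j x \<le> D i x" if "i \<le> j" for i j x
  proof -
    \<comment> \<open>The smaller step is a convex combination of no step and the larger step.\<close>
    define \<theta> where "\<theta> = real (Suc i) / real (Suc j)"
    have \<theta>: "0 \<le> \<theta>" "\<theta> \<le> 1" using that by (auto simp: \<theta>_def)
    have "G ((1 - \<theta>) *\<^sub>R e x + \<theta> *\<^sub>R (e x - R x / real (Suc i)))
        \<le> (1 - \<theta>) * G (e x) + \<theta> * G (e x - R x / real (Suc i))"
      using \<theta> by (intro convex_onD[OF G(1)]) auto
    moreover have "(1 - \<theta>) *\<^sub>R e x + \<theta> *\<^sub>R (e x - R x / real (Suc i)) = e x - R x / real (Suc j)"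
    proof -
      have "\<theta> * (R x / real (Suc i)) = R x / real (Suc j)"
        by (simp add: \<theta>_def del: of_nat_Suc)
      then show ?thesis by (simp add: algebra_simps del: of_nat_Suc)
    qed
    ultimately have "G (e x - R x / real (Suc j)) - G (e x) \<le> \<theta> * (G (e x - R x / real (Suc i)) - G (e x))"
      by (simp add: algebra_simps)
    then have "D j x \<le> real (Suc j) * (\<theta> * (G (e x - R x / real (Suc i)) - G (e x)))"
      unfolding D_def by (intro mult_left_mono) auto
    also have "\<dots> = D i x" by (simp add: \<theta>_def D_def)
    finally show ?thesis .
  qed
  have neg: "\<exists>N. D N x < 0" if x: "x \<in> {a..b}" "x \<notin> Z" for x
  proof -
    have eR: "0 < e x * R x" using Z x by simp
    then have ne: "e x \<noteq> 0" by auto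
    have q: "0 < R x / e x" using eR by (auto simp: zero_less_divide_iff zero_less_mult_iff)
    obtain N where N: "R x / e x < real (Suc N)"
      using reals_Archimedean2 by (metis less_trans of_nat_less_iff lessI)
    \<comment> \<open>For such \<open>N\<close> the point \<open>e x - R x / (N + 1)\<close> lies strictly between \<open>0\<close> and \<open>e x\<close>.\<close>
    define \<theta> where "\<theta> = R x / e x / real (Suc N)"
    have \<theta>: "0 < \<theta>" "\<theta> < 1"
      unfolding \<theta>_def using q N by (simp only: zero_less_divide_iff of_nat_0_less_iff, simp)
        (metis N divide_less_eq_1_pos of_nat_0_less_iff zero_less_Suc)
    have "G ((1 - \<theta>) *\<^sub>R e x + \<theta> *\<^sub>R 0) \<le> (1 - \<theta>) * G (e x) + \<theta> * G 0"
      using \<theta> by (intro convex_onD[OF G(1)]) auto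
    also have "\<dots> < G (e x)" using \<theta> G(2) G(3)[OF ne] by (simp add: algebra_simps)
    also have "(1 - \<theta>) *\<^sub>R e x + \<theta> *\<^sub>R 0 = e x - R x / real (Suc N)"
      using ne by (simp add: \<theta>_def left_diff_distrib)
    finally have "D N x < 0" by (simp add: D_def mult_pos_neg)
    then show ?thesis ..
  qed
  have "infinite {a..b}" using ab by simp
  then obtain x0 where x0: "x0 \<in> {a..b}" "x0 \<notin> Z" using Z(1) by (meson finite_subset subsetI)
  obtain N where N: "D N x0 < 0" using neg[OF x0] ..
  define \<nu> where "\<nu> = integral {a..b} (\<lambda>x. min (D N x) 0)"
  have "continuous_on {a..b} (\<lambda>x. - min (D N x) 0)"
    by (intro continuous_intros contD)
  then have "integral {a..b} (\<lambda>x. - min (D N x) 0) \<noteq> 0"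
    using integral_eq_0_iff[of a b "\<lambda>x. - min (D N x) 0"] ab x0 N by force
  moreover have "integral {a..b} (\<lambda>x. - min (D N x) 0) \<ge> 0"
    by (intro integral_nonneg integrable_neg intmin) auto
  ultimately have \<nu>: "\<nu> < 0" by (simp add: \<nu>_def)
  define H where "H i x = (if x \<in> Z then 0 else max (D i x) 0)" for i x
  have negl: "negligible Z" using Z(1) by (rule negligible_finite)
  have H_lim: "(\<lambda>i. integral {a..b} (H i)) \<longlonglongrightarrow> integral {a..b} (\<lambda>x. 0)"
  proof (rule dominated_convergence(2))
    show "H i integrable_on {a..b}" for i
      by (rule integrable_spike[OF intmax[of i] negl]) (auto simp: H_def)
    show "(\<lambda>x. max (D 0 x) 0) integrable_on {a..b}" by (rule intmax)
    show "norm (H i x) \<le> max (D 0 x) 0" for i x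
      using antimono[of 0 i x] by (auto simp: H_def)
    show "(\<lambda>i. H i x) \<longlonglongrightarrow> 0" if x: "x \<in> {a..b}" for x
    proof (cases "x \<in> Z")
      case False
      obtain M where M: "D M x < 0" using neg[OF x False] ..
      have "H i x = 0" if "i \<ge> M" for i
        using antimono[OF that, of x] M by (simp add: H_def)
      then show ?thesis by (intro tendsto_eventually eventually_sequentiallyI)
    qed (simp add: H_def)
  qed
  have "- \<nu> \<le> integral {a..b} (H i)" if i: "i \<ge> N" for i
  proof -
    have "integral {a..b} (\<lambda>x. min (D i x) 0) \<le> \<nu>"
      unfolding \<nu>_def using antimono[OF i] by (intro integral_le intmin) (auto simp: min_le_iff_disj)
    moreover have "integral {a..b} (H i) = integral {a..b} (\<lambda>x. max (D i x) 0)"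
      by (rule integral_spike[OF negl]) (auto simp: H_def)
    moreover have "integral {a..b} (D i) =
        integral {a..b} (\<lambda>x. max (D i x) 0) + integral {a..b} (\<lambda>x. min (D i x) 0)"
      by (subst integral_add[OF intmax intmin, symmetric]) (auto intro!: integral_cong simp: max_def min_def)
    ultimately show ?thesis using D_nonneg[of i] by linarith
  qed
  then have "- \<nu> \<le> integral {a..b} (\<lambda>x. 0::real)"
    using LIMSEQ_le_const[OF H_lim] by blast
  then show False using \<nu> by simp
qed

text \<open>The midpoint \<open>Q\<close> of two minimizers is again one, and the convexity inequality between the three
  integrands must be an equality everywhere. Where \<open>f = Q\<close> it gives \<open>f = P1 = P2\<close>, so the zeros of
  \<open>f - Q\<close> are among those of \<open>P1 - P2\<close> and there are at most \<open>n - 1\<close> of them. Then some \<open>R\<close>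
  in the space matches the sign of \<open>f - Q\<close>, and \<open>Q\<close> can be improved in this direction.\<close>
lemma minimizer_unique:
  fixes G f :: "real \<Rightarrow> real"
  assumes ab: "a < b"
    and G: "convex_on UNIV G" "G 0 = 0" "\<And>x. x \<noteq> 0 \<Longrightarrow> G x > 0"
    and T: "tchebycheff_space a b n S" and f: "continuous_on {a..b} f"
    and P1: "P1 \<in> S" "\<And>Q. Q \<in> S \<Longrightarrow>
      integral {a..b} (\<lambda>x. G (f x - P1 x)) \<le> integral {a..b} (\<lambda>x. G (f x - Q x))"
    and P2: "P2 \<in> S" "\<And>Q. Q \<in> S \<Longrightarrow>
      integral {a..b} (\<lambda>x. G (f x - P2 x)) \<le> integral {a..b} (\<lambda>x. G (f x - Q x))"
  shows "P1 = P2"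
proof (rule ccontr)
  assume ne: "P1 \<noteq> P2"
  define J where "J Q = integral {a..b} (\<lambda>x. G (f x - Q x))" for Q
  have J: "J P1 \<le> J Q" "J P2 \<le> J Q" if "Q \<in> S" for Q
    using P1(2) P2(2) that by (auto simp: J_def)
  have JP: "J P2 = J P1" using J P1(1) P2(1) by (simp add: antisym)
  note sub = tchebycheff_subspace[OF T]
  have n: "0 < n"
  proof (rule ccontr)
    assume "\<not> 0 < n"
    then have "S = {0}" using T unfolding tchebycheff_space_def by (auto simp: card_eq_0_iff)
    then show False using P1(1) P2(1) ne by auto
  qed
  have cont: "continuous_on {a..b} (\<lambda>x. G (f x - Q x))" if "Q \<in> S" for Q
    using continuous_on_compose2[OF convex_on_UNIV_continuous[OF G(1), of UNIV]
        continuous_on_diff[OF f tchebycheff_continuous[OF T that]]] by simp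
  note int = integrable_continuous_real[OF cont]
  define Q where "Q = (1/2) *\<^sub>R P1 + (1/2) *\<^sub>R P2"
  have QS: "Q \<in> S" unfolding Q_def using sub P1(1) P2(1) by (intro subspace_add subspace_scale)
  define e where "e x = f x - Q x" for x
  have e_mid: "e x = (1 - 1/2) *\<^sub>R (f x - P1 x) + (1/2) *\<^sub>R (f x - P2 x)" for x
    by (simp add: e_def Q_def scaleR_fun_def field_simps)
  have conte: "continuous_on {a..b} e"
    unfolding e_def by (intro continuous_on_diff f tchebycheff_continuous[OF T QS])
  define gap where "gap x = (G (f x - P1 x) / 2 + G (f x - P2 x) / 2) - G (f x - Q x)" for x
  have gap_nonneg: "0 \<le> gap x" for x
    using convex_onD[OF G(1), of "1/2" "f x - P1 x" "f x - P2 x"] e_mid[of x]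
    by (simp add: gap_def e_def)
  have contgap: "continuous_on {a..b} gap"
    unfolding gap_def by (intro continuous_intros cont P1(1) P2(1) QS) auto
  have "integral {a..b} gap = (J P1 / 2 + J P2 / 2) - J Q"
    unfolding gap_def J_def using int P1(1) P2(1) QS
    by (simp add: integral_diff integral_add integrable_add)
  also have "\<dots> \<le> 0" using J(1)[OF QS] JP by simp
  finally have int_le: "integral {a..b} gap \<le> 0" .
  moreover have "0 \<le> integral {a..b} gap"
    using gap_nonneg contgap by (intro integral_nonneg integrable_continuous_real) auto
  ultimately have "integral {a..b} gap = 0" by simp
  then have gap0: "gap x = 0" if "x \<in> {a..b}" for x
    using integral_eq_0_iff[OF contgap ab] gap_nonneg that by blast
  have sub0: "{x \<in> {a..b}. e x = 0} \<subseteq> {x \<in> {a..b}. (P1 - P2) x = 0}"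
  proof safe
    fix x assume x: "x \<in> {a..b}" "e x = 0"
    have nonneg: "0 \<le> G t" for t using G(2,3) by (cases "t = 0") (auto intro: less_imp_le)
    have "G (f x - P1 x) + G (f x - P2 x) = 0"
      using gap0[OF x(1)] x(2) G(2) by (simp add: gap_def e_def)
    then have "G (f x - P1 x) = 0" "G (f x - P2 x) = 0"
      using nonneg[of "f x - P1 x"] nonneg[of "f x - P2 x"] by auto
    then have "f x - P1 x = 0" "f x - P2 x = 0" using G(3) by (metis less_irrefl)+
    then show "(P1 - P2) x = 0" by simp
  qed
  have "P1 - P2 \<in> S" "P1 - P2 \<noteq> 0" using subspace_diff[OF sub P1(1) P2(1)] ne by auto
  then have "finite {x \<in> {a..b}. (P1 - P2) x = 0}" "card {x \<in> {a..b}. (P1 - P2) x = 0} \<le> n - 1"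
    using T unfolding tchebycheff_space_def by blast+
  then have fin: "finite {x \<in> {a..b}. e x = 0}" and card: "card {x \<in> {a..b}. e x = 0} \<le> n - 1"
    using sub0 finite_subset card_mono[OF _ sub0] by (blast, linarith)
  obtain R where R: "R \<in> S" "R \<noteq> 0" "\<And>x. x \<in> {a..<b} \<Longrightarrow> 0 \<le> e x * R x"
    using sign_matching[OF ab T n conte fin card] by metis
  define Z where "Z = {x \<in> {a..b}. e x = 0} \<union> {x \<in> {a..b}. R x = 0} \<union> {b}"
  have finZ: "finite Z" using T R(1,2) fin unfolding Z_def tchebycheff_space_def by auto
  have "0 < e x * R x" if "x \<in> {a..b}" "x \<notin> Z" for x
    using R(3)[of x] that by (auto simp: Z_def less_le)
  then obtain s where s: "integral {a..b} (\<lambda>x. G (e x - s * R x)) < integral {a..b} (\<lambda>x. G (e x))"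
    using descent_direction[OF ab G conte tchebycheff_continuous[OF T R(1)] finZ] by blast
  have "Q + s *\<^sub>R R \<in> S" using sub QS R(1) by (intro subspace_add subspace_scale)
  moreover have "J (Q + s *\<^sub>R R) < J Q" using s by (simp add: J_def e_def scaleR_fun_def diff_diff_eq)
  moreover have "J Q = J P1"
    using \<open>integral {a..b} gap = (J P1 / 2 + J P2 / 2) - J Q\<close> \<open>integral {a..b} gap = 0\<close> JP by simp
  ultimately show False using J(1) by (metis not_less)
qed

section \<open>Best approximations\<close>

lemma best_approximation_iff_minimizer:
  assumes \<Phi>: "convex_on UNIV (\<lambda>x. \<Phi> \<bar>x\<bar>)" "\<And>x. 0 \<le> \<Phi> \<bar>x\<bar>"
    and S: "S \<subseteq> cont_space a b" and f: "continuous_on {a..b} f"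
  shows "best_approximation a b \<Phi> S f P \<longleftrightarrow> P \<in> S \<and> (\<forall>Q\<in>S.
    integral {a..b} (\<lambda>x. \<Phi> \<bar>f x - P x\<bar>) \<le> integral {a..b} (\<lambda>x. \<Phi> \<bar>f x - Q x\<bar>))"
proof -
  define J where "J Q = integral {a..b} (\<lambda>x. \<Phi> \<bar>f x - Q x\<bar>)" for Q
  have int: "(LINT x:{a..b}|lebesgue. \<Phi> \<bar>f x - Q x\<bar>) = J Q" and nonneg: "0 \<le> J Q" if "Q \<in> S" for Q
  proof -
    have "continuous_on {a..b} Q" using S that by (auto simp: cont_space_def)
    then have c: "continuous_on {a..b} (\<lambda>x. \<Phi> \<bar>f x - Q x\<bar>)"
      using continuous_on_compose2[OF convex_on_UNIV_continuous[OF \<Phi>(1), of UNIV]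
        continuous_on_diff[OF f]] by simp
    then show "(LINT x:{a..b}|lebesgue. \<Phi> \<bar>f x - Q x\<bar>) = J Q"
      unfolding J_def
      by (intro set_lebesgue_integral_eq_integral absolutely_integrable_continuous_real)
    show "0 \<le> J Q" unfolding J_def by (intro integral_nonneg integrable_continuous_real c \<Phi>)
  qed
  have inf: "(INF Q\<in>S. LINT x:{a..b}|lebesgue. \<Phi> \<bar>f x - Q x\<bar>) = (INF Q\<in>S. J Q)"
    using int by (intro INF_cong) auto
  have bdd: "bdd_below (J ` S)" using nonneg by (intro bdd_belowI2[of _ 0]) auto
  have "P \<in> S \<and> J P = (INF Q\<in>S. J Q) \<longleftrightarrow> P \<in> S \<and> (\<forall>Q\<in>S. J P \<le> J Q)"
  proof safe
    fix Q assume "J P = (INF Q\<in>S. J Q)" "Q \<in> S"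
    then show "J P \<le> J Q" using cINF_lower[OF bdd] by simp
  next
    assume P: "P \<in> S" "\<forall>Q\<in>S. J P \<le> J Q"
    then show "J P = (INF Q\<in>S. J Q)"
      by (intro antisym cINF_greatest cINF_lower[OF bdd]) auto
  qed
  then show ?thesis unfolding best_approximation_def inf using int by (auto simp: J_def)
qed

theorem theorem3p1:
  fixes a b :: real and n :: nat and S :: "(real \<Rightarrow> real) set"
    and \<Phi> f :: "real \<Rightarrow> real"
  assumes "a < b"
    and "\<Phi> \<in> Psi_class" and "Delta2 \<Phi>"
    and "tchebycheff_space a b n S"
    and "continuous_on {a..b} f"
  shows "\<exists>!P. best_approximation a b \<Phi> S f P"
proof -
  define G where "G = (\<lambda>x. \<Phi> \<bar>x\<bar>)"
  have "convex_on {0..} \<Phi>" using assms(2) by (simp add: Psi_class_def)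
  then have G: "convex_on UNIV G" "G 0 = 0" "\<And>x. x \<noteq> 0 \<Longrightarrow> G x > 0"
    using convex_on_even_extension[of \<Phi>] Psi_class_pos[OF assms(2)] by (auto simp: G_def)
  obtain B where B: "finite B" "independent B" "span B = S" and S: "S \<subseteq> cont_space a b"
    using assms(4) unfolding tchebycheff_space_def by blast
  have "B \<subseteq> cont_space a b" using S B(3) span_superset by blast
  then obtain P where P: "P \<in> S" "\<And>Q. Q \<in> S \<Longrightarrow>
      integral {a..b} (\<lambda>x. G (f x - P x)) \<le> integral {a..b} (\<lambda>x. G (f x - Q x))"
    using exists_minimizer[OF assms(1) G assms(5) B(1,2)] B(3) by blast
  have "0 \<le> G x" for x using G(2,3) by (cases "x = 0") (auto intro: less_imp_le)
  then have iff: "best_approximation a b \<Phi> S f Q \<longleftrightarrow> Q \<in> S \<and> (\<forall>Q'\<in>S.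
      integral {a..b} (\<lambda>x. G (f x - Q x)) \<le> integral {a..b} (\<lambda>x. G (f x - Q' x)))" for Q
    using best_approximation_iff_minimizer[OF _ _ S assms(5), of \<Phi>] G(1) by (simp add: G_def)
  show ?thesis
  proof (rule ex1I)
    show "best_approximation a b \<Phi> S f P" using P by (simp add: iff)
    fix Q assume "best_approximation a b \<Phi> S f Q"
    then show "Q = P" using minimizer_unique[OF assms(1) G assms(4,5), of Q P] P by (auto simp: iff)
  qed
qed

end
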